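(* In the disclosure game without commitment under transparency (the buyer observes the object's profitability), full disclosure, i.e. $d^*(x,y)=1$ for all $(x,y)\in\mathcal X\times\mathcal Y$, is the unique equilibrium disclosure strategy.
   Context: Let $\mathcal X=[x_{min},x_{max}]$ and $\mathcal Y=[y_{min},y_{max}]$ be nondegenerate compact intervals; $y_{min}$ may be negative. An object has a profitability $y\in\mathcal Y$ to a seller, with marginal cdf $F_Y$. Conditional on $y$, the seller observes a signal realization $x\in\mathcal X$ with cdf $F_{X|y}$; a signal realization is identified with the posterior mean of the object's value to the buyer that it induces, which does not depend on $y$. Standing assumptions: $F_Y$ has full support on $\mathcal Y$ and each $F_{X|y}$ has full support on $\mathcal X$; the joint distribution of $(x,y)$ has no mass points, in the sense that for every $a\in\mathcal X$ and measurable $\varphi:\mathcal X\to\mathbb R$ the event $\{(x-a)(y-\varphi(x))=0\}$ has probability zero. The demand function $p:\mathcal X\to[0,1]$ is strictly increasing and differentiable; $p(\hat x)$ is the probability that the buyer purchases when the buyer's posterior mean is $\hat x$. The seller's payoff is $y$ if the object is sold and $0$ otherwise. Disclosure game without commitment, under transparency: the seller observes $(x,y)$ and then chooses whether to disclose $x$; the buyer always observes $y$. If $x$ is disclosed, the buyer's posterior mean is $x$; if not, it is some $\hat x_y\in\mathcal X$ that may depend on $y$. A (perfect Bayesian) equilibrium is a measurable disclosure strategy $d^*:(x,y)\mapsto d^*(x,y)\in[0,1]$ together with $(\hat x_y)_{y\in\mathcal Y}$ such that (a) for every $(x,y)$, the seller's choice maximizes the expected payoff, which is $y\,p(x)$ from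 disclosing and $y\,p(\hat x_y)$ from not disclosing, and (b) for every $y$, $\hat x_y$ equals the conditional expectation of $x$ (under $F_{X|y}$) given non-disclosure at profitability $y$ whenever $\int_{\mathcal X}(1-d^*(x,y))\,dF_{X|y}(x)>0$ (and is an arbitrary element of $\mathcal X$ otherwise). Convention: when indifferent, the seller discloses. *)

theory Defs
  imports "HOL-Probability.Probability"
begin

text \<open>
  Distributions on an interval \<open>S\<close> are represented by probability measures on its Borel sigma
  algebra rather than by cdfs, and the family \<open>F\<^bsub>X|y\<^esub>\<close> by a probability kernel.  A signal
  realization is identified with the posterior mean it induces.
\<close>

abbreviation borel_on :: "real set \<Rightarrow> real measure" where
  "borel_on S \<equiv> restrict_space borel S"

definition full_support_on :: "real set \<Rightarrow> real measure \<Rightarrow> bool" where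
  "full_support_on S M \<longleftrightarrow>
     M \<in> space (prob_algebra (borel_on S)) \<and>
     (\<forall>U. open U \<and> U \<inter> S \<noteq> {} \<longrightarrow> measure M (U \<inter> S) > 0)"

definition joint_distribution ::
  "real set \<Rightarrow> real set \<Rightarrow> real measure \<Rightarrow> (real \<Rightarrow> real measure) \<Rightarrow> (real \<times> real) measure" where
  "joint_distribution X Y F_Y F_X =
     F_Y \<bind> (\<lambda>y. F_X y \<bind> (\<lambda>x. return (borel_on X \<Otimes>\<^sub>M borel_on Y) (x, y)))"

definition no_mass_points :: "real set \<Rightarrow> (real \<times> real) measure \<Rightarrow> bool" where
  "no_mass_points X J \<longleftrightarrow>
     (\<forall>a\<in>X. \<forall>\<phi> \<in> borel_measurable (borel_on X).
        \<P>(z in J. (fst z - a) * (snd z - \<phi> (fst z)) = 0) = 0)"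

text \<open>
  Expected payoff of a seller with profitability \<open>y\<close> and signal \<open>x\<close> who discloses with
  probability \<open>e\<close>, when non-disclosure induces the posterior mean \<open>m\<close>.
\<close>

definition seller_payoff :: "(real \<Rightarrow> real) \<Rightarrow> real \<Rightarrow> real \<Rightarrow> real \<Rightarrow> real \<Rightarrow> real" where
  "seller_payoff p x y m e = e * (y * p x) + (1 - e) * (y * p m)"

definition nondisclosure_prob ::
  "(real \<Rightarrow> real measure) \<Rightarrow> (real \<times> real \<Rightarrow> real) \<Rightarrow> real \<Rightarrow> real" where
  "nondisclosure_prob F_X d y = (\<integral>x. 1 - d (x, y) \<partial>F_X y)"

definition nondisclosure_mean ::
  "(real \<Rightarrow> real measure) \<Rightarrow> (real \<times> real \<Rightarrow> real) \<Rightarrow> real \<Rightarrow> real" where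
  "nondisclosure_mean F_X d y =
     (\<integral>x. x * (1 - d (x, y)) \<partial>F_X y) / nondisclosure_prob F_X d y"

text \<open>
  The buyer observes \<open>y\<close>, so the non-disclosure belief \<open>xhat y\<close> depends on \<open>y\<close> and is updated
  under the conditional distribution \<open>F_X y\<close>.  The penultimate conjunct is the convention that an
  indifferent seller discloses.
\<close>

definition transparent_equilibrium ::
  "real set \<Rightarrow> real set \<Rightarrow> (real \<Rightarrow> real measure) \<Rightarrow> (real \<Rightarrow> real) \<Rightarrow>
   (real \<times> real \<Rightarrow> real) \<Rightarrow> (real \<Rightarrow> real) \<Rightarrow> bool" where
  "transparent_equilibrium X Y F_X p d xhat \<longleftrightarrow>
     d \<in> borel_measurable (borel_on X \<Otimes>\<^sub>M borel_on Y) \<and>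
     (\<forall>x\<in>X. \<forall>y\<in>Y. d (x, y) \<in> {0..1}) \<and>
     (\<forall>y\<in>Y. xhat y \<in> X) \<and>
     (\<forall>x\<in>X. \<forall>y\<in>Y.
        is_arg_max (seller_payoff p x y (xhat y)) (\<lambda>e. e \<in> {0..1}) (d (x, y))) \<and>
     (\<forall>x\<in>X. \<forall>y\<in>Y. y * p x = y * p (xhat y) \<longrightarrow> d (x, y) = 1) \<and>
     (\<forall>y\<in>Y. nondisclosure_prob F_X d y > 0 \<longrightarrow> xhat y = nondisclosure_mean F_X d y)"

definition transparent_equilibrium_strategy ::
  "real set \<Rightarrow> real set \<Rightarrow> (real \<Rightarrow> real measure) \<Rightarrow> (real \<Rightarrow> real) \<Rightarrow>
   (real \<times> real \<Rightarrow> real) \<Rightarrow> bool" where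
  "transparent_equilibrium_strategy X Y F_X p d \<longleftrightarrow>
     (\<exists>xhat. transparent_equilibrium X Y F_X p d xhat)"

end

theory Submission imports Defs begin

text \<open>
  Fix \<open>y\<close> and a non-disclosure belief \<open>h\<close>. Since \<open>p\<close> is increasing, the seller hides exactly the
  signals in the open half line \<open>{x. 0 < y * (h - x)}\<close>, all of which lie strictly on one side of
  \<open>h\<close>. If this set met the signal space, full support would give it positive probability, and the
  conditional mean over it could not equal \<open>h\<close>: hence nothing is hidden. Conversely, full disclosure
  is supported by the most pessimistic belief from the seller's point of view, that is \<open>x_min\<close> for
  \<open>y \<ge> 0\<close> and \<open>x_max\<close> for \<open>y < 0\<close>.
\<close>

text \<open>The integrand \<open>y * (h - x)\<close> is positive on \<open>U\<close>, so its
  integral over \<open>U\<close> would be positive, whereas it would vanish if \<open>h\<close> were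
  the mean over \<open>U\<close>. Keeping the factor \<open>y\<close> treats lower half lines
  (\<open>y > 0\<close>) and upper ones (\<open>y < 0\<close>) at once.\<close>

lemma full_support_half_line_mean_neq:
  fixes a b h y :: real
  assumes supp: "full_support_on {a..b} M"
    and ne: "{x. 0 < y * (h - x)} \<inter> {a..b} \<noteq> {}"
  defines "U \<equiv> {x. 0 < y * (h - x)}"
  shows "(0::real) < (\<integral>x. indicator U x \<partial>M)"
    and "h \<noteq> (\<integral>x. x * indicator U x \<partial>M) / (\<integral>x. indicator U x \<partial>M)"
proof -
  have opn: "open U"
    unfolding U_def by (intro open_Collect_less continuous_intros)
  have M: "prob_space M" "sets M = sets (borel_on {a..b})"
    using supp by (auto simp: full_support_on_def space_prob_algebra)
  interpret prob_space M by fact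
  have sp: "space M = {a..b}"
    using sets_eq_imp_space_eq[OF M(2)] by (simp add: space_restrict_space)
  have meas: "f \<in> borel_measurable M" if "f \<in> borel_measurable borel" for f :: "real \<Rightarrow> real"
    using measurable_restrict_space1[OF that, of "{a..b}"] measurable_cong_sets[OF M(2) refl] by blast
  have U_borel [measurable]: "U \<in> sets borel"
    using opn by simp
  have UM: "U \<inter> {a..b} \<in> sets M"
    unfolding M(2) by (auto simp: sets_restrict_space)
  have pos: "0 < measure M (U \<inter> {a..b})"
    using supp opn ne unfolding full_support_on_def U_def by blast
  have int: "(\<integral>x. indicator U x \<partial>M :: real) = measure M (U \<inter> {a..b})"
    by (simp add: sp)
  show "(0::real) < (\<integral>x. indicator U x \<partial>M)"
    using pos int by simp
  have i1: "integrable M (indicator U :: real \<Rightarrow> real)"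
    by (rule integrable_const_bound[where B=1]) (auto intro!: meas simp: indicator_def)
  have i2: "integrable M (\<lambda>x. x * indicator U x :: real)"
    by (rule integrable_const_bound[where B="\<bar>a\<bar> + \<bar>b\<bar>"])
      (auto intro!: meas AE_I2 simp: indicator_def sp)
  \<comment> \<open>This is \<open>y * (h - x)\<close> cut off outside \<open>U\<close>, expanded so
    that linearity yields the two integrals in the quotient.\<close>
  let ?g = "\<lambda>x. y * (h * indicator U x - x * indicator U x) :: real"
  have ig: "integrable M ?g"
    using i1 i2 by simp
  have nonneg: "0 \<le> ?g x" for x
    by (auto simp: indicator_def U_def)
  show "h \<noteq> (\<integral>x. x * indicator U x \<partial>M) / (\<integral>x. indicator U x \<partial>M)"
  proof
    assume "h = (\<integral>x. x * indicator U x \<partial>M) / (\<integral>x. indicator U x \<partial>M)"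
    then have "h * (\<integral>x. indicator U x \<partial>M) = (\<integral>x. x * indicator U x \<partial>M)"
      using \<open>(0::real) < (\<integral>x. indicator U x \<partial>M)\<close> by (simp add: nonzero_eq_divide_eq)
    moreover have "(\<integral>x. ?g x \<partial>M) =
        y * (h * (\<integral>x. indicator U x \<partial>M) - (\<integral>x. x * indicator U x \<partial>M))"
      using i1 i2 by (simp only: integral_mult_right_zero Bochner_Integration.integral_diff
          integrable_mult_right)
    ultimately have "(\<integral>x. ?g x \<partial>M) = 0"
      by simp
    then have "AE x in M. ?g x = 0"
      using integral_nonneg_eq_0_iff_AE[OF ig] nonneg by simp
    \<comment> \<open>By the definition of \<open>U\<close>, \<open>?g\<close> is strictly positive
      there, so its zero set avoids \<open>U\<close>.\<close>
    then have "AE x in M. x \<notin> U \<inter> {a..b}"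
      by eventually_elim (auto simp: indicator_def U_def)
    then have "measure M (U \<inter> {a..b}) = 0"
      using prob_eq_0[OF UM] by simp
    with pos show False by simp
  qed
qed

lemma seller_payoff_alt:
  "seller_payoff p x y m e = y * p m + e * (y * p x - y * p m)"
  by (simp add: seller_payoff_def algebra_simps)

text \<open>The payoff is affine in the disclosure probability, so comparing the endpoints 1 and 0
  decides whether 1 is optimal.\<close>

lemma full_disclosure_optimal_iff:
  "is_arg_max (seller_payoff p x y m) (\<lambda>e. e \<in> {0..1}) 1 \<longleftrightarrow> y * p m \<le> y * p x"
proof
  assume "is_arg_max (seller_payoff p x y m) (\<lambda>e. e \<in> {0..1}) 1"
  then have "\<not> seller_payoff p x y m 1 < seller_payoff p x y m 0"
    unfolding is_arg_max_def by (metis atLeastAtMost_iff order_refl zero_le_one)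
  then show "y * p m \<le> y * p x" by (simp add: seller_payoff_alt)
next
  assume "y * p m \<le> y * p x"
  then have "e * (y * p x - y * p m) \<le> y * p x - y * p m" if "0 \<le> e" "e \<le> 1" for e
    using that by (intro mult_left_le_one_le) auto
  then show "is_arg_max (seller_payoff p x y m) (\<lambda>e. e \<in> {0..1}) 1"
    by (fastforce simp: is_arg_max_def seller_payoff_alt)
qed

text \<open>An affine payoff with nonzero slope has a unique maximizer on \<open>{0..1}\<close>, the
  endpoint picked by the sign of the slope.\<close>

lemma optimal_disclosure_strict:
  assumes "is_arg_max (seller_payoff p x y m) (\<lambda>e. e \<in> {0..1}) e" "y * p x \<noteq> y * p m"
  shows "e = (if y * p x < y * p m then 0 else 1)"
proof -
  have e: "0 \<le> e" "e \<le> 1"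
    and opt: "\<And>e'. 0 \<le> e' \<Longrightarrow> e' \<le> 1 \<Longrightarrow>
      e' * (y * p x - y * p m) \<le> e * (y * p x - y * p m)"
    using assms(1) by (auto simp: is_arg_max_def seller_payoff_alt not_less)
  show ?thesis
  proof (cases "y * p x < y * p m")
    case True
    then show ?thesis using opt[of 0] e by (auto simp: zero_le_mult_iff)
  next
    case False
    then have "0 < y * p x - y * p m" using assms(2) by linarith
    with opt[of 1] e False show ?thesis by simp
  qed
qed

text \<open>A negative \<open>y\<close> reverses both comparisons, and \<open>y = 0\<close> makes
  both sides false. This turns the payoff comparison into membership in a half line.\<close>

lemma strict_mono_on_scaled_less_iff:
  fixes p :: "real \<Rightarrow> real"
  assumes "strict_mono_on X p" "x \<in> X" "h \<in> X"
  shows "y * p x < y * p h \<longleftrightarrow> 0 < y * (h - x)"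
  using strict_mono_on_less[OF assms] strict_mono_on_less[OF assms(1,3,2)]
  by (auto simp: mult_less_cancel_left zero_less_mult_iff)

lemma transparent_equilibrium_full_disclosure:
  assumes eq: "transparent_equilibrium {a..b} Y F_X p d xhat"
    and supp: "full_support_on {a..b} (F_X y)" and mono: "strict_mono_on {a..b} p"
    and "x \<in> {a..b}" "y \<in> Y"
  shows "d (x, y) = 1"
proof (rule ccontr)
  assume hidden: "d (x, y) \<noteq> 1"
  define h where "h = xhat y"
  define U where "U = {x. 0 < y * (h - x)}"
  have h: "h \<in> {a..b}"
    using eq \<open>y \<in> Y\<close> by (simp add: transparent_equilibrium_def h_def)
  \<comment> \<open>Ties are disclosed by convention and strict preferences force an endpoint, so no
    signal is disclosed with an intermediate probability.\<close>
  have nd: "1 - d (t, y) = indicator U t" if t: "t \<in> {a..b}" for t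
  proof (cases "y * p t = y * p h")
    case True
    then have "d (t, y) = 1"
      using eq t \<open>y \<in> Y\<close> unfolding transparent_equilibrium_def h_def by blast
    moreover have "t \<notin> U"
      using True strict_mono_on_scaled_less_iff[OF mono t h, of y] unfolding U_def
      by (metis less_irrefl mem_Collect_eq)
    ultimately show ?thesis by simp
  next
    case False
    have "is_arg_max (seller_payoff p t y h) (\<lambda>e. e \<in> {0..1}) (d (t, y))"
      using eq t \<open>y \<in> Y\<close> unfolding transparent_equilibrium_def h_def by blast
    from optimal_disclosure_strict[OF this False] show ?thesis
      by (simp add: strict_mono_on_scaled_less_iff[OF mono t h] U_def)
  qed
  have sp: "space (F_X y) = {a..b}"
    using supp sets_eq_imp_space_eq[of "F_X y" "borel_on {a..b}"]
    by (auto simp: full_support_on_def space_prob_algebra space_restrict_space)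
  have ne: "{x. 0 < y * (h - x)} \<inter> {a..b} \<noteq> {}"
  proof -
    have "x \<in> U"
      using nd[OF \<open>x \<in> {a..b}\<close>] hidden by (cases "x \<in> U") auto
    then show ?thesis
      using \<open>x \<in> {a..b}\<close> unfolding U_def by blast
  qed
  note neq = full_support_half_line_mean_neq[OF supp ne, folded U_def]
  have prob: "nondisclosure_prob F_X d y = (\<integral>x. indicator U x \<partial>F_X y)"
    unfolding nondisclosure_prob_def by (intro Bochner_Integration.integral_cong) (auto simp: nd sp)
  have mean: "nondisclosure_mean F_X d y =
      (\<integral>x. x * indicator U x \<partial>F_X y) / (\<integral>x. indicator U x \<partial>F_X y)"
    unfolding nondisclosure_mean_def prob
    by (intro arg_cong2[where f="(/)"] Bochner_Integration.integral_cong) (auto simp: nd sp)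
  \<comment> \<open>Non-disclosure has positive probability by \<open>neq(1)\<close>, so the belief
    must be the conditional mean.\<close>
  have "h = nondisclosure_mean F_X d y"
    using eq neq(1) \<open>y \<in> Y\<close> unfolding transparent_equilibrium_def prob[symmetric] h_def by blast
  with neq(2) mean show False by simp
qed

text \<open>Non-disclosure has probability zero here, so the belief may be chosen freely; at the
  chosen endpoint \<open>h\<close>, no signal \<open>x\<close> satisfies
  \<open>0 < y * (h - x)\<close>.\<close>

lemma full_disclosure_transparent_equilibrium:
  assumes "a \<le> b" "strict_mono_on {a..b} p"
  shows "transparent_equilibrium {a..b} Y F_X p (\<lambda>_. 1) (\<lambda>y. if 0 \<le> y then a else b)"
proof -
  have "y * p (if 0 \<le> y then a else b) \<le> y * p x" if "x \<in> {a..b}" for x y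
    using strict_mono_on_scaled_less_iff[OF assms(2) that, of "if 0 \<le> y then a else b" y] that assms(1)
    by (auto simp: not_less[symmetric] zero_less_mult_iff split: if_splits)
  then show ?thesis
    using assms(1)
    by (auto simp: transparent_equilibrium_def full_disclosure_optimal_iff nondisclosure_prob_def
        simp del: atLeastAtMost_iff) auto
qed

theorem proposition7:
  fixes x_min x_max y_min y_max :: real
    and X Y :: "real set"
    and F_Y :: "real measure" and F_X :: "real \<Rightarrow> real measure"
    and p :: "real \<Rightarrow> real"
  assumes "x_min < x_max" and "y_min < y_max"
    and "X = {x_min..x_max}" and "Y = {y_min..y_max}"
    and "full_support_on Y F_Y"
    and "F_X \<in> borel_on Y \<rightarrow>\<^sub>M prob_algebra (borel_on X)"
    and "\<And>y. y \<in> Y \<Longrightarrow> full_support_on X (F_X y)"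
    and "no_mass_points X (joint_distribution X Y F_Y F_X)"
    and "p \<in> X \<rightarrow> {0..1}" and "strict_mono_on X p" and "p differentiable_on X"
  shows "transparent_equilibrium_strategy X Y F_X p (\<lambda>_. 1) \<and>
    (\<forall>d. transparent_equilibrium_strategy X Y F_X p d \<longrightarrow> (\<forall>x\<in>X. \<forall>y\<in>Y. d (x, y) = 1))"
  unfolding transparent_equilibrium_strategy_def
  using full_disclosure_transparent_equilibrium[of x_min x_max p Y F_X]
    transparent_equilibrium_full_disclosure[of x_min x_max Y F_X p] assms
  by (metis less_imp_le)

end
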